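(* Let $\gamma,\nu$ be positive integers, $n=\gamma\nu$, and let $X\in\Pi_n$ be an $n\times n$ permutation matrix. Then $X$ is a block permutation matrix (with respect to blocks of size $\nu\times\nu$) if and only if $$\sum_{(u,v)\in U_{k,b}^{(l)}}X_{u,v}=1$$ holds for all $b,k\in\{1,\dots,\gamma\}$ and all $l\in\{1,\dots,\nu\}$.
   Context: For integers $\alpha\le\beta$, $[\alpha,\beta]$ is the set of integers from $\alpha$ to $\beta$. For $k,b\in[1,\gamma]$, the block $B_{k,b}$ is $\{(i,j)\in[1,n]^2 : \nu(k-1)<i\le\nu k,\ \nu(b-1)<j\le\nu b\}$. $X(B_{k,b})$ denotes the $\nu\times\nu$ submatrix of $X$ on the positions in $B_{k,b}$. A permutation matrix $X\in\Pi_n$ is a block permutation matrix if for every $b\in[1,\gamma]$ there exists a unique $k\in[1,\gamma]$ with $X(B_{k,b})\neq0$. For $k,b\in[1,\gamma]$ and $l\in[1,\nu]$ put $$T_{k,b}^{(l)}=\{(x,y)\in B_{k,b} : y=\nu(b-1)+l\},$$ and define the skewed column set $$U_{k,b}^{(l)}=T_{k,b}^{(l)}\cup\bigcup_{k'\in[1,\gamma]\setminus\{k\}}T_{k',b}^{((l\bmod\nu)+1)} .$$ *)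

theory Defs
  imports "Jordan_Normal_Form.DL_Submatrix"
begin

text \<open>Matrices of type \<^typ>\<open>real mat\<close> are indexed from 0, whereas rows, columns, blocks and
  position sets are numbered from 1 below. Only \<open>entry\<close> and \<open>submat_at\<close> convert between the two.\<close>

definition entry :: "real mat \<Rightarrow> nat \<Rightarrow> nat \<Rightarrow> real" where
  "entry X u v = X $$ (u - 1, v - 1)"

definition perm_mats :: "nat \<Rightarrow> real mat set" where
  "perm_mats n = {X \<in> carrier_mat n n.
     (\<forall>u\<in>{1..n}. \<forall>v\<in>{1..n}. entry X u v \<in> {0, 1}) \<and>
     (\<forall>u\<in>{1..n}. \<exists>!v. v \<in> {1..n} \<and> entry X u v = 1) \<and>
     (\<forall>v\<in>{1..n}. \<exists>!u. u \<in> {1..n} \<and> entry X u v = 1)}"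

text \<open>Throughout, \<open>\<gamma>\<close> is the number of blocks in each direction and \<open>\<nu>\<close> the block size, so the
  matrices have dimension \<open>\<gamma> * \<nu>\<close>. The truncating \<open>k - 1\<close>, \<open>b - 1\<close> are harmless for
  \<open>k, b \<in> {1..\<gamma>}\<close>.\<close>

definition block :: "nat \<Rightarrow> nat \<Rightarrow> nat \<Rightarrow> nat \<Rightarrow> (nat \<times> nat) set" where
  "block \<gamma> \<nu> k b = {(i, j) \<in> {1..\<gamma> * \<nu>} \<times> {1..\<gamma> * \<nu>}.
     \<nu> * (k - 1) < i \<and> i \<le> \<nu> * k \<and> \<nu> * (b - 1) < j \<and> j \<le> \<nu> * b}"

text \<open>The submatrix on a rectangular set \<open>S\<close> of positions: its row set and column set are the two
  projections of \<open>S\<close>, shifted to 0-based indices.\<close>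

definition submat_at :: "real mat \<Rightarrow> (nat \<times> nat) set \<Rightarrow> real mat" where
  "submat_at X S = submatrix X ((\<lambda>(i, j). i - 1) ` S) ((\<lambda>(i, j). j - 1) ` S)"

definition block_perm_mat :: "nat \<Rightarrow> nat \<Rightarrow> real mat \<Rightarrow> bool" where
  "block_perm_mat \<gamma> \<nu> X \<longleftrightarrow> X \<in> perm_mats (\<gamma> * \<nu>) \<and>
     (\<forall>b\<in>{1..\<gamma>}. \<exists>!k. k \<in> {1..\<gamma>} \<and> submat_at X (block \<gamma> \<nu> k b) \<noteq> 0\<^sub>m \<nu> \<nu>)"

definition col_set :: "nat \<Rightarrow> nat \<Rightarrow> nat \<Rightarrow> nat \<Rightarrow> nat \<Rightarrow> (nat \<times> nat) set" where
  "col_set \<gamma> \<nu> k b l = {(x, y) \<in> block \<gamma> \<nu> k b. y = \<nu> * (b - 1) + l}"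

definition skewed_col_set :: "nat \<Rightarrow> nat \<Rightarrow> nat \<Rightarrow> nat \<Rightarrow> nat \<Rightarrow> (nat \<times> nat) set" where
  "skewed_col_set \<gamma> \<nu> k b l =
     col_set \<gamma> \<nu> k b l \<union> (\<Union>k'\<in>{1..\<gamma>} - {k}. col_set \<gamma> \<nu> k' b (l mod \<nu> + 1))"

end

theory Submission
  imports Defs
begin

text \<open>For a permutation matrix, the part of column \<open>\<nu> * (b - 1) + l\<close> inside \<open>block \<gamma> \<nu> k b\<close> sums
  to 1 if the unique 1 of that column lies in block row \<open>k\<close>, and to 0 otherwise. So a skewed column
  sum equals 1 for every \<open>k\<close> iff cyclically consecutive columns of the block column have their 1 in
  the same block row, that is, iff one block row serves the whole block column.\<close>

section \<open>Blocks as index rectangles and as submatrices\<close>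

lemma pick_atLeastLessThan:
  assumes "i < c"
  shows "pick {a..<a + c} i = a + i"
proof -
  \<comment> \<open>Exactly i elements of the interval lie below \<open>a + i\<close>, and
    \<open>pick_card_in_set\<close> recovers an element from that count.\<close>
  have "{x \<in> {a..<a + c}. x < a + i} = {a..<a + i}"
    using assms by auto
  then show ?thesis
    using pick_card_in_set[of "a + i" "{a..<a + c}"] assms by simp
qed

text \<open>Leaves \<open>\<nu> * (k - 1)\<close> as the only product in the bounds of a block, so
  that linear arithmetic suffices from here on.\<close>

lemma block_index_bounds:
  fixes k \<gamma> \<nu> :: nat
  assumes "k \<in> {1..\<gamma>}"
  shows "\<nu> * k = \<nu> * (k - 1) + \<nu>" and "\<nu> * (k - 1) + \<nu> \<le> \<gamma> * \<nu>"
proof -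
  show *: "\<nu> * k = \<nu> * (k - 1) + \<nu>"
    using assms by (cases k) auto
  have "\<nu> * k \<le> \<nu> * \<gamma>"
    using assms by (intro mult_le_mono2) auto
  then show "\<nu> * (k - 1) + \<nu> \<le> \<gamma> * \<nu>"
    using * by (simp add: mult.commute)
qed

lemma block_eq_Times:
  assumes "k \<in> {1..\<gamma>}" "b \<in> {1..\<gamma>}"
  shows "block \<gamma> \<nu> k b =
    {\<nu> * (k - 1)<..\<nu> * (k - 1) + \<nu>} \<times> {\<nu> * (b - 1)<..\<nu> * (b - 1) + \<nu>}"
  using block_index_bounds[OF assms(1), of \<nu>] block_index_bounds[OF assms(2), of \<nu>]
  unfolding block_def by auto

lemma image_pred_greaterThanAtMost:
  "(\<lambda>i. i - 1) ` {a<..a + c} = {a..<a + c}" for a c :: nat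
proof
  show "{a..<a + c} \<subseteq> (\<lambda>i. i - 1) ` {a<..a + c}"
  proof
    fix x assume "x \<in> {a..<a + c}"
    then show "x \<in> (\<lambda>i. i - 1) ` {a<..a + c}"
      by (intro image_eqI[of _ _ "Suc x"]) auto
  qed
qed auto

lemma submat_at_block:
  assumes X: "X \<in> carrier_mat (\<gamma> * \<nu>) (\<gamma> * \<nu>)" and "\<nu> > 0"
    and k: "k \<in> {1..\<gamma>}" and b: "b \<in> {1..\<gamma>}"
  shows "submat_at X (block \<gamma> \<nu> k b) =
    mat \<nu> \<nu> (\<lambda>(i, j). X $$ (\<nu> * (k - 1) + i, \<nu> * (b - 1) + j))"
proof -
  let ?I = "{\<nu> * (k - 1)..<\<nu> * (k - 1) + \<nu>}" and ?J = "{\<nu> * (b - 1)..<\<nu> * (b - 1) + \<nu>}"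
  \<comment> \<open>Projecting a product recovers a factor as long as the other factor is nonempty,
    which \<open>\<nu> > 0\<close> ensures for blocks.\<close>
  have rows: "(\<lambda>(i, j). i - 1) ` (A \<times> B) = (\<lambda>i. i - 1) ` A" if "B \<noteq> {}"
    for A B :: "nat set" using that by force
  have cols: "(\<lambda>(i, j). j - 1) ` (A \<times> B) = (\<lambda>j. j - 1) ` B" if "A \<noteq> {}"
    for A B :: "nat set" using that by force
  have ne: "{a<..a + \<nu>} \<noteq> {}" for a
    using \<open>\<nu> > 0\<close> by auto
  have proj: "(\<lambda>(i, j). i - 1) ` block \<gamma> \<nu> k b = ?I" "(\<lambda>(i, j). j - 1) ` block \<gamma> \<nu> k b = ?J"
    unfolding block_eq_Times[OF k b] rows[OF ne] cols[OF ne] image_pred_greaterThanAtMost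
    by simp_all
  \<comment> \<open>\<open>submatrix\<close> takes its dimensions from the number of selected
    indices inside the matrix. The block fits, so nothing is cut off and both counts are
    \<nu>.\<close>
  have "{i. i < \<gamma> * \<nu> \<and> i \<in> ?I} = ?I" "{j. j < \<gamma> * \<nu> \<and> j \<in> ?J} = ?J"
    using block_index_bounds(2)[OF k, of \<nu>] block_index_bounds(2)[OF b, of \<nu>] by auto
  then have "card {i. i < dim_row X \<and> i \<in> ?I} = \<nu>" "card {j. j < dim_col X \<and> j \<in> ?J} = \<nu>"
    using X by auto
  then show ?thesis
    unfolding submat_at_def proj submatrix_def
    by (auto simp: pick_atLeastLessThan)
qed

lemma submat_at_block_nonzero_iff:
  assumes X: "X \<in> carrier_mat (\<gamma> * \<nu>) (\<gamma> * \<nu>)" and "\<nu> > 0"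
    and k: "k \<in> {1..\<gamma>}" and b: "b \<in> {1..\<gamma>}"
  shows "submat_at X (block \<gamma> \<nu> k b) \<noteq> 0\<^sub>m \<nu> \<nu> \<longleftrightarrow>
    (\<exists>(u, v)\<in>block \<gamma> \<nu> k b. entry X u v \<noteq> 0)"
proof -
  have "submat_at X (block \<gamma> \<nu> k b) \<noteq> 0\<^sub>m \<nu> \<nu> \<longleftrightarrow>
      (\<exists>i<\<nu>. \<exists>j<\<nu>. entry X (\<nu> * (k - 1) + Suc i) (\<nu> * (b - 1) + Suc j) \<noteq> 0)"
    unfolding submat_at_block[OF assms] by (auto simp: mat_eq_iff entry_def)
  also have "\<dots> \<longleftrightarrow> (\<exists>(u, v)\<in>block \<gamma> \<nu> k b. entry X u v \<noteq> 0)"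
  proof
    assume "\<exists>(u, v)\<in>block \<gamma> \<nu> k b. entry X u v \<noteq> 0"
    then obtain u v where uv: "entry X u v \<noteq> 0" "\<nu> * (k - 1) < u" "u \<le> \<nu> * (k - 1) + \<nu>"
      "\<nu> * (b - 1) < v" "v \<le> \<nu> * (b - 1) + \<nu>"
      unfolding block_eq_Times[OF k b] by auto
    \<comment> \<open>These differences are the 0-based offsets in the block; the strict lower
      bounds on u and v keep the subtractions from truncating.\<close>
    then have "u - \<nu> * (k - 1) - 1 < \<nu>" "v - \<nu> * (b - 1) - 1 < \<nu>"
      "\<nu> * (k - 1) + Suc (u - \<nu> * (k - 1) - 1) = u"
      "\<nu> * (b - 1) + Suc (v - \<nu> * (b - 1) - 1) = v" by linarith+
    then show "\<exists>i<\<nu>. \<exists>j<\<nu>. entry X (\<nu> * (k - 1) + Suc i) (\<nu> * (b - 1) + Suc j) \<noteq> 0"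
      using uv(1) by metis
  qed (fastforce simp: block_eq_Times[OF k b])
  finally show ?thesis .
qed

section \<open>Sums over column pieces, and constancy along a cycle\<close>

lemma col_set_eq_image:
  assumes "k \<in> {1..\<gamma>}" "b \<in> {1..\<gamma>}" "l \<in> {1..\<nu>}"
  shows "col_set \<gamma> \<nu> k b l =
    (\<lambda>u. (u, \<nu> * (b - 1) + l)) ` {\<nu> * (k - 1)<..\<nu> * (k - 1) + \<nu>}"
  using assms(3) unfolding col_set_def block_eq_Times[OF assms(1,2)] by auto

text \<open>Makes the block row a function of u, so that disjointness of block rows comes for free.
  At \<open>u = 0\<close> truncation would wrongly give block row 1.\<close>

lemma block_row_iff:
  fixes k u \<nu> :: nat
  assumes "\<nu> > 0" "k \<ge> 1" "u \<ge> 1"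
  shows "u \<in> {\<nu> * (k - 1)<..\<nu> * (k - 1) + \<nu>} \<longleftrightarrow> (u - 1) div \<nu> + 1 = k"
proof -
  have "m div \<nu> = q \<longleftrightarrow> \<nu> * q \<le> m \<and> m < \<nu> * q + \<nu>" for m q
    using div_nat_eqI[of \<nu> q m] div_times_less_eq_dividend[of m \<nu>]
      dividend_less_div_times[OF assms(1), of m]
    by (auto simp: mult.commute)
  moreover have "u \<in> {\<nu> * (k - 1)<..\<nu> * (k - 1) + \<nu>} \<longleftrightarrow>
      \<nu> * (k - 1) \<le> u - 1 \<and> u - 1 < \<nu> * (k - 1) + \<nu>"
    using assms(3) by auto
  moreover have "(u - 1) div \<nu> + 1 = k \<longleftrightarrow> (u - 1) div \<nu> = k - 1"
    using assms(2) by linarith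
  ultimately show ?thesis
    by simp
qed

lemma sum_col_set:
  assumes "\<nu> > 0" and k: "k \<in> {1..\<gamma>}" and b: "b \<in> {1..\<gamma>}" and l: "l \<in> {1..\<nu>}"
    and r: "r \<in> {1..\<gamma> * \<nu>}"
    and X: "\<And>u. u \<in> {1..\<gamma> * \<nu>} \<Longrightarrow> entry X u (\<nu> * (b - 1) + l) = of_bool (u = r)"
  shows "(\<Sum>(u, v)\<in>col_set \<gamma> \<nu> k b l. entry X u v) = of_bool ((r - 1) div \<nu> + 1 = k)"
proof -
  let ?R = "{\<nu> * (k - 1)<..\<nu> * (k - 1) + \<nu>}"
  have "(\<Sum>(u, v)\<in>col_set \<gamma> \<nu> k b l. entry X u v) = (\<Sum>u\<in>?R. entry X u (\<nu> * (b - 1) + l))"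
    unfolding col_set_eq_image[OF k b l] by (subst sum.reindex) (auto simp: inj_on_def)
  also have "\<dots> = (\<Sum>u\<in>?R. if u = r then 1 else 0)"
    using block_index_bounds(2)[OF k, of \<nu>] by (intro sum.cong refl, subst X) auto
  also have "\<dots> = of_bool (r \<in> ?R)"
    by simp
  also have "r \<in> ?R \<longleftrightarrow> (r - 1) div \<nu> + 1 = k"
    using k r by (intro block_row_iff[OF \<open>\<nu> > 0\<close>]) auto
  finally show ?thesis .
qed

text \<open>Here \<open>g l\<close> is the block row holding the 1 of the l-th column. The pieces of
  the next column over all \<open>k' \<noteq> k\<close> miss its 1 exactly when that 1 lies in block
  row k. The total is therefore 1 iff \<open>g l = k\<close> and
  \<open>g (l mod \<nu> + 1) = k\<close> are both true or both false.\<close>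

lemma sum_skewed_col_set:
  assumes "\<nu> > 0" and k: "k \<in> {1..\<gamma>}" and b: "b \<in> {1..\<gamma>}" and l: "l \<in> {1..\<nu>}"
    and g: "\<And>k l. k \<in> {1..\<gamma>} \<Longrightarrow> l \<in> {1..\<nu>} \<Longrightarrow>
      (\<Sum>(u, v)\<in>col_set \<gamma> \<nu> k b l. entry X u v) = of_bool (g l = k)"
    and g_range: "\<And>l. l \<in> {1..\<nu>} \<Longrightarrow> g l \<in> {1..\<gamma>}"
  shows "(\<Sum>(u, v)\<in>skewed_col_set \<gamma> \<nu> k b l. entry X u v) =
    of_bool (g l = k) + of_bool (g (l mod \<nu> + 1) \<noteq> k)"
proof -
  let ?l = "l mod \<nu> + 1"
  have l': "?l \<in> {1..\<nu>}"
    using \<open>\<nu> > 0\<close> by (simp add: Suc_leI)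
  have fin: "finite (col_set \<gamma> \<nu> k' b l')" for k' l'
    by (rule finite_subset[of _ "{1..\<gamma> * \<nu>} \<times> {1..\<gamma> * \<nu>}"]) (auto simp: col_set_def block_def)
  have disj: "col_set \<gamma> \<nu> k1 b l1 \<inter> col_set \<gamma> \<nu> k2 b l2 = {}"
    if "k1 \<noteq> k2" "k1 \<in> {1..\<gamma>}" "k2 \<in> {1..\<gamma>}" for k1 k2 l1 l2
  proof -
    \<comment> \<open>\<open>block_row_iff\<close> would assign both k1 and k2 to the same row u; it
      requires \<open>u \<ge> 1\<close>, hence the separate case \<open>u = 0\<close>.\<close>
    have "\<not> (\<nu> * (k1 - 1) < u \<and> u \<le> \<nu> * (k1 - 1) + \<nu> \<and>
        \<nu> * (k2 - 1) < u \<and> u \<le> \<nu> * (k2 - 1) + \<nu>)" for u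
      using that block_row_iff[OF \<open>\<nu> > 0\<close>, of k1 u] block_row_iff[OF \<open>\<nu> > 0\<close>, of k2 u]
      by (cases "u = 0") auto
    then show ?thesis
      using b that unfolding col_set_def by (auto simp: block_eq_Times)
  qed
  let ?S = "\<lambda>A. \<Sum>(u, v)\<in>A. entry X u v"
  have "?S (skewed_col_set \<gamma> \<nu> k b l) =
      ?S (col_set \<gamma> \<nu> k b l) + ?S (\<Union>k'\<in>{1..\<gamma>} - {k}. col_set \<gamma> \<nu> k' b ?l)"
    unfolding skewed_col_set_def
  proof (rule sum.union_disjoint)
    show "col_set \<gamma> \<nu> k b l \<inter> (\<Union>k'\<in>{1..\<gamma>} - {k}. col_set \<gamma> \<nu> k' b ?l) = {}"
      using disj k by blast
  qed (use fin in auto)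
  also have "?S (\<Union>k'\<in>{1..\<gamma>} - {k}. col_set \<gamma> \<nu> k' b ?l) =
      (\<Sum>k'\<in>{1..\<gamma>} - {k}. ?S (col_set \<gamma> \<nu> k' b ?l))"
    using fin disj by (intro sum.UNION_disjoint) auto
  also have "\<dots> = (\<Sum>k'\<in>{1..\<gamma>} - {k}. if g ?l = k' then 1 else 0)"
    using g l' by (intro sum.cong) auto
  \<comment> \<open>By \<open>g_range\<close> the value \<open>g ?l\<close> is a valid block row, so
    it is one of the summation indices unless it equals k.\<close>
  also have "\<dots> = of_bool (g ?l \<noteq> k)"
    using g_range[OF l'] by auto
  finally show ?thesis
    using g[OF k l] by simp
qed

text \<open>For \<open>l < m\<close> the cyclic successor is \<open>Suc l\<close>, so equality
  propagates from 1 upwards by induction. Conversely, the successor stays in the range, where every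
  value is \<open>g 1\<close>.\<close>

lemma cyclic_const_iff:
  fixes g :: "nat \<Rightarrow> 'a"
  shows "(\<forall>l\<in>{1..m}. g l = g (l mod m + 1)) \<longleftrightarrow> (\<forall>l\<in>{1..m}. g l = g 1)"
proof
  assume step: "\<forall>l\<in>{1..m}. g l = g (l mod m + 1)"
  show "\<forall>l\<in>{1..m}. g l = g 1"
  proof
    fix l assume "l \<in> {1..m}"
    then have "1 \<le> l" "l \<le> m" by auto
    then show "g l = g 1"
    proof (induction l rule: dec_induct)
      case (step l)
      then show ?case
        using \<open>\<forall>l\<in>{1..m}. g l = g (l mod m + 1)\<close>[rule_format, of l] by simp
    qed simp
  qed
next
  assume const: "\<forall>l\<in>{1..m}. g l = g 1"
  show "\<forall>l\<in>{1..m}. g l = g (l mod m + 1)"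
  proof
    fix l assume l: "l \<in> {1..m}"
    then have "l mod m + 1 \<in> {1..m}"
      by (simp add: Suc_leI)
    then show "g l = g (l mod m + 1)"
      using const l by metis
  qed
qed

section \<open>Reduction to a single block column\<close>

lemma perm_mats_column:
  assumes "X \<in> perm_mats n" "v \<in> {1..n}"
  obtains r where "r \<in> {1..n}" "\<And>u. u \<in> {1..n} \<Longrightarrow> entry X u v = of_bool (u = r)"
proof -
  have "\<exists>!u. u \<in> {1..n} \<and> entry X u v = 1" and "\<forall>u\<in>{1..n}. entry X u v \<in> {0, 1}"
    using assms unfolding perm_mats_def by blast+
  then show ?thesis
    by (metis insert_iff empty_iff of_bool_eq that)
qed

theorem theorem3:
  fixes \<gamma> \<nu> n :: nat and X :: "real mat"
  assumes "\<gamma> > 0" and "\<nu> > 0" and "n = \<gamma> * \<nu>" and "X \<in> perm_mats n"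
  shows "block_perm_mat \<gamma> \<nu> X \<longleftrightarrow>
    (\<forall>b\<in>{1..\<gamma>}. \<forall>k\<in>{1..\<gamma>}. \<forall>l\<in>{1..\<nu>}.
       (\<Sum>(u, v)\<in>skewed_col_set \<gamma> \<nu> k b l. entry X u v) = 1)"
proof -
  have X: "X \<in> perm_mats (\<gamma> * \<nu>)" "X \<in> carrier_mat (\<gamma> * \<nu>) (\<gamma> * \<nu>)"
    using assms unfolding perm_mats_def by auto
  have "\<forall>v\<in>{1..\<gamma> * \<nu>}. \<exists>r. r \<in> {1..\<gamma> * \<nu>} \<and>
      (\<forall>u\<in>{1..\<gamma> * \<nu>}. entry X u v = of_bool (u = r))"
    using perm_mats_column[OF X(1)] by metis
  then obtain r where r: "\<And>v. v \<in> {1..\<gamma> * \<nu>} \<Longrightarrow> r v \<in> {1..\<gamma> * \<nu>}"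
    "\<And>u v. v \<in> {1..\<gamma> * \<nu>} \<Longrightarrow> u \<in> {1..\<gamma> * \<nu>} \<Longrightarrow> entry X u v = of_bool (u = r v)"
    by metis
  \<comment> \<open>Both conditions quantify over b on the outside, so they can be compared for each
    block column separately.\<close>
  have "(\<exists>!k. k \<in> {1..\<gamma>} \<and> submat_at X (block \<gamma> \<nu> k b) \<noteq> 0\<^sub>m \<nu> \<nu>) \<longleftrightarrow>
      (\<forall>k\<in>{1..\<gamma>}. \<forall>l\<in>{1..\<nu>}. (\<Sum>(u, v)\<in>skewed_col_set \<gamma> \<nu> k b l. entry X u v) = 1)"
    if b: "b \<in> {1..\<gamma>}" for b
  proof -
    define c where "c l = \<nu> * (b - 1) + l" for l
    define g where "g l = (r (c l) - 1) div \<nu> + 1" for l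
    have c: "c l \<in> {1..\<gamma> * \<nu>}" if "l \<in> {1..\<nu>}" for l
      using that block_index_bounds(2)[OF b, of \<nu>] unfolding c_def by auto
    have g_range: "g l \<in> {1..\<gamma>}" if "l \<in> {1..\<nu>}" for l
    proof -
      have "r (c l) - 1 < \<gamma> * \<nu>"
        using r(1)[OF c[OF that]] by auto
      then show ?thesis
        unfolding g_def by (simp add: less_mult_imp_div_less Suc_leI)
    qed
    have col: "(\<Sum>(u, v)\<in>col_set \<gamma> \<nu> k b l. entry X u v) = of_bool (g l = k)"
      if "k \<in> {1..\<gamma>}" "l \<in> {1..\<nu>}" for k l
      using r c[OF that(2)] sum_col_set[OF \<open>\<nu> > 0\<close> that(1) b that(2)]
      unfolding g_def c_def by blast
    \<comment> \<open>The nonzero blocks of the block column are thus indexed by the values of g,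
      and a unique nonzero block means that g takes one value only.\<close>
    have nonzero: "submat_at X (block \<gamma> \<nu> k b) \<noteq> 0\<^sub>m \<nu> \<nu> \<longleftrightarrow> (\<exists>l\<in>{1..\<nu>}. g l = k)"
      if k: "k \<in> {1..\<gamma>}" for k
    proof -
      \<comment> \<open>The column is quantified first, since within column \<open>c l\<close> the
        only candidate row is \<open>r (c l)\<close>.\<close>
      have "submat_at X (block \<gamma> \<nu> k b) \<noteq> 0\<^sub>m \<nu> \<nu> \<longleftrightarrow>
          (\<exists>v\<in>{\<nu> * (b - 1)<..\<nu> * (b - 1) + \<nu>}.
            \<exists>u\<in>{\<nu> * (k - 1)<..\<nu> * (k - 1) + \<nu>}. entry X u v \<noteq> 0)"
        by (subst submat_at_block_nonzero_iff[OF X(2) \<open>\<nu> > 0\<close> k b])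
          (auto simp: block_eq_Times[OF k b])
      also have "{\<nu> * (b - 1)<..\<nu> * (b - 1) + \<nu>} = c ` {1..\<nu>}"
        unfolding c_def image_add_atLeastAtMost by auto
      also have "(\<exists>v\<in>c ` {1..\<nu>}. \<exists>u\<in>{\<nu> * (k - 1)<..\<nu> * (k - 1) + \<nu>}. entry X u v \<noteq> 0) \<longleftrightarrow>
          (\<exists>l\<in>{1..\<nu>}. r (c l) \<in> {\<nu> * (k - 1)<..\<nu> * (k - 1) + \<nu>})"
      proof -
        have "(\<exists>u\<in>{\<nu> * (k - 1)<..\<nu> * (k - 1) + \<nu>}. entry X u (c l) \<noteq> 0) \<longleftrightarrow>
            r (c l) \<in> {\<nu> * (k - 1)<..\<nu> * (k - 1) + \<nu>}" if "l \<in> {1..\<nu>}" for l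
        proof -
          have "entry X u (c l) \<noteq> 0 \<longleftrightarrow> u = r (c l)"
            if "u \<in> {\<nu> * (k - 1)<..\<nu> * (k - 1) + \<nu>}" for u
            using that block_index_bounds(2)[OF k, of \<nu>] r(2)[OF c[OF \<open>l \<in> {1..\<nu>}\<close>], of u]
            by auto
          then show ?thesis by blast
        qed
        then show ?thesis by blast
      qed
      also have "\<dots> \<longleftrightarrow> (\<exists>l\<in>{1..\<nu>}. g l = k)"
        unfolding g_def using k r(1)[OF c] block_row_iff[OF \<open>\<nu> > 0\<close>]
        by (intro bex_cong refl) auto
      finally show ?thesis .
    qed
    have one: "1 \<in> {1..\<nu>}"
      using \<open>\<nu> > 0\<close> by simp
    have "(\<exists>!k. k \<in> {1..\<gamma>} \<and> submat_at X (block \<gamma> \<nu> k b) \<noteq> 0\<^sub>m \<nu> \<nu>) \<longleftrightarrow>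
        (\<exists>!k. \<exists>l\<in>{1..\<nu>}. g l = k)"
      by (intro arg_cong[of _ _ Ex1] ext) (use nonzero g_range in blast)
    \<comment> \<open>\<open>g 1\<close> is a value that is attained, as \<open>\<nu> > 0\<close>,
      so it must be the unique one.\<close>
    also have "\<dots> \<longleftrightarrow> (\<forall>l\<in>{1..\<nu>}. g l = g 1)"
      using one by (intro iffI) (blast, metis)
    also have "\<dots> \<longleftrightarrow> (\<forall>l\<in>{1..\<nu>}. g l = g (l mod \<nu> + 1))"
      by (rule cyclic_const_iff[symmetric])
    \<comment> \<open>From right to left, take \<open>k = g l\<close>, which \<open>g_range\<close>
      allows.\<close>
    also have "\<dots> \<longleftrightarrow> (\<forall>k\<in>{1..\<gamma>}. \<forall>l\<in>{1..\<nu>}. g l = k \<longleftrightarrow> g (l mod \<nu> + 1) = k)"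
      using g_range by metis
    also have "\<dots> \<longleftrightarrow> (\<forall>k\<in>{1..\<gamma>}. \<forall>l\<in>{1..\<nu>}.
        (\<Sum>(u, v)\<in>skewed_col_set \<gamma> \<nu> k b l. entry X u v) = 1)"
      using sum_skewed_col_set[OF \<open>\<nu> > 0\<close> _ b _ col g_range]
      by (intro ball_cong refl) auto
    finally show ?thesis .
  qed
  then show ?thesis
    using X(1) unfolding block_perm_mat_def by blast
qed

end
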